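(* Let $n\ge 3$, $b>2$, and let $\widetilde b<1$ be such that $\widetilde T_n$ is nonsingular. Then $$\|\widetilde T_n^{-1}\|_\infty\le\frac{\gamma_{n+1}-2\gamma_{\frac{n+1}{2}}}{(b-2)\gamma_{n+1}}+\frac{|K|}{b-2}(\gamma_n+\gamma_1)(\gamma_{n+1}-\gamma_n-\gamma_1)+\frac{|K\beta|}{b-2}\gamma_{n-1}\gamma_{n+1},$$ where $\beta=\widetilde b-b$ and $K=\dfrac{\beta}{(\gamma_{n+1}+\beta\gamma_n)^2-(\beta\gamma_1)^2}$.
   Context: For an integer $n\ge 3$ and real $b,\widetilde b$, $\widetilde T_n$ is the $n\times n$ real symmetric tridiagonal matrix with diagonal entries $(\widetilde b,b,b,\dots,b,\widetilde b)$ (first and last equal to $\widetilde b$, all others equal to $b$) and all sub- and superdiagonal entries equal to $-1$. For $b>2$ put $r_1=\tfrac12(b+\sqrt{b^2-4})$, $r_2=\tfrac12(b-\sqrt{b^2-4})$ (both positive) and $\gamma_k=r_1^k-r_2^k$ for real $k\ge 0$ (in particular half-integer $k$ is allowed). $\|A\|_\infty=\max_i\sum_j|a_{i,j}|$. *)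

theory Defs
  imports Complex_Main "Jordan_Normal_Form.Gauss_Jordan_Elimination"
begin

definition T_tilde :: "nat \<Rightarrow> real \<Rightarrow> real \<Rightarrow> real mat" where
  "T_tilde n b bt = mat n n (\<lambda>(i, j).
     if i = j then (if i = 0 \<or> i = n - 1 then bt else b)
     else if i = Suc j \<or> j = Suc i then - 1
     else 0)"

definition r1 :: "real \<Rightarrow> real" where
  "r1 b = (b + sqrt (b\<^sup>2 - 4)) / 2"

definition r2 :: "real \<Rightarrow> real" where
  "r2 b = (b - sqrt (b\<^sup>2 - 4)) / 2"

(* For b > 2 both bases are positive, so powr is the ordinary real power;
   the exponent is real because (n + 1) / 2 need not be an integer. *)
definition \<gamma> :: "real \<Rightarrow> real \<Rightarrow> real" where
  "\<gamma> b k = r1 b powr k - r2 b powr k"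

(* Maximum absolute row sum; only meaningful for a matrix with at least one row. *)
definition mat_norm_inf :: "real mat \<Rightarrow> real" where
  "mat_norm_inf A = Max ((\<lambda>i. \<Sum>j<dim_col A. \<bar>A $$ (i, j)\<bar>) ` {..<dim_row A})"

end

theory Submission
  imports Defs "Jordan_Normal_Form.Determinant"
begin

text \<open>
  The perturbed matrix is the Toeplitz matrix \<open>T\<close> (with \<open>b\<close> on the whole diagonal) plus
  \<open>\<beta>\<close> in the two corners. The columns of its inverse solve the recurrence
  \<open>b F(x) = F(x - 1) + F(x + 1)\<close> off the diagonal, with the boundary conditions
  \<open>F(0) + \<beta> F(1) = 0\<close> and \<open>F(n + 1) + \<beta> F(n) = 0\<close>. Hence they are the Green function of
  \<open>T\<close> plus a correction in the span of \<open>\<gamma>(x)\<close> and \<open>\<gamma>(n + 1 - x)\<close>, whose coefficients have the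
  common factor \<open>K\<close>. The three terms of the bound are the row sums of the Green function
  and of the two parts of the correction.

  All identities between the \<open>\<gamma>\<close> follow from \<open>\<gamma>(x) = 2 sinh (t x)\<close>, where \<open>b = 2 cosh t\<close>.
\<close>

section \<open>Hyperbolic identities, inequalities and sums of \<open>\<gamma>\<close>\<close>

text \<open>\<open>r1 b\<close> and \<open>r2 b\<close> have sum \<open>b\<close> and product 1, so
  they are \<open>exp t\<close> and \<open>exp (- t)\<close> for
  \<open>t = ln (r1 b)\<close>.\<close>

lemma \<gamma>_eq_sinh:
  assumes "b > 2"
  obtains t where "t > 0" "b = 2 * cosh t" "\<And>x. \<gamma> b x = 2 * sinh (t * x)"
proof -
  define q where "q = sqrt (b\<^sup>2 - 4)"
  have b4: "b\<^sup>2 > 4"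
    using assms power_strict_mono[of 2 b 2] by simp
  have q2: "q\<^sup>2 = b\<^sup>2 - 4" and q0: "q > 0"
    using b4 by (auto simp: q_def)
  have prod: "r1 b * r2 b = 1"
    using q2 by (simp add: r1_def r2_def flip: q_def) (simp add: field_simps power2_eq_square)
  have r1_gt: "r1 b > 1"
    using q0 assms by (simp add: r1_def flip: q_def)
  define t where "t = ln (r1 b)"
  have t: "t > 0"
    using r1_gt by (simp add: t_def)
  have e1: "r1 b = exp t"
    using r1_gt by (simp add: t_def)
  have e2: "r2 b = exp (- t)"
    using prod e1 r1_gt by (simp add: exp_minus field_simps)
  have "b = r1 b + r2 b"
    by (simp add: r1_def r2_def field_simps)
  then have "b = 2 * cosh t"
    by (simp add: e1 e2 cosh_def)
  moreover have "\<gamma> b x = 2 * sinh (t * x)" for x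
    by (simp add: \<gamma>_def e1 e2 sinh_def powr_def mult.commute)
  ultimately show thesis
    using t that by blast
qed

lemma \<gamma>_0 [simp]: "b > 2 \<Longrightarrow> \<gamma> b 0 = 0"
  by (erule \<gamma>_eq_sinh) simp

lemma \<gamma>_uminus: "b > 2 \<Longrightarrow> \<gamma> b (- x) = - \<gamma> b x"
  by (erule \<gamma>_eq_sinh) simp

lemma \<gamma>_strict_mono: "b > 2 \<Longrightarrow> x < y \<Longrightarrow> \<gamma> b x < \<gamma> b y"
  by (erule \<gamma>_eq_sinh) simp

lemma \<gamma>_pos: "b > 2 \<Longrightarrow> 0 < x \<Longrightarrow> 0 < \<gamma> b x"
  using \<gamma>_strict_mono[of b 0 x] by simp

lemma \<gamma>_nonneg: "b > 2 \<Longrightarrow> 0 \<le> x \<Longrightarrow> 0 \<le> \<gamma> b x"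
  using \<gamma>_pos[of b x] by (cases "x = 0") auto

lemma \<gamma>_rec: "b > 2 \<Longrightarrow> b * \<gamma> b x = \<gamma> b (x - 1) + \<gamma> b (x + 1)"
  by (erule \<gamma>_eq_sinh) (simp add: ring_distribs sinh_add sinh_diff)

text \<open>A discrete Wronskian identity. It supplies the normalisation of \<open>green\<close>,
  the factorisation of the denominator of \<open>K\<close>, and the closed form of the row sums of
  \<open>green\<close>.\<close>

lemma \<gamma>_mult_diff:
  assumes "b > 2"
  shows "\<gamma> b (x + a) * \<gamma> b (y + a) - \<gamma> b x * \<gamma> b y = \<gamma> b a * \<gamma> b (x + y + a)"
proof -
  \<comment> \<open>The addition theorems written as a polynomial identity: \<open>A\<close>,
    \<open>B\<close> stand for sinh and cosh of \<open>t * x\<close>, \<open>C\<close>,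
    \<open>D\<close> for those of \<open>t * y\<close>, and \<open>s\<close>, \<open>c\<close> for
    those of \<open>t * a\<close>.\<close>
  have "(A * c + B * s) * (C * c + D * s) - A * C = s * ((A * D + B * C) * c + (B * D + A * C) * s)"
    if "c\<^sup>2 = s\<^sup>2 + 1" for A B C D c s :: real
    using that by Groebner_Basis.algebra
  note * = this[OF cosh_square_eq]
  show ?thesis
  proof (rule \<gamma>_eq_sinh[OF assms])
    fix t :: real
    assume t: "\<And>x. \<gamma> b x = 2 * sinh (t * x)"
    show ?thesis
      unfolding t using *[of "sinh (t * x)" "t * a" "cosh (t * x)" "sinh (t * y)" "cosh (t * y)"]
      by (simp add: distrib_left[of t] sinh_add cosh_add) Groebner_Basis.algebra
  qed
qed

text \<open>For a fixed sum \<open>x + y\<close>, the difference \<open>x - y\<close> enters only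
  through the cosh factor. The next two inequalities rest on this.\<close>

lemma \<gamma>_add:
  assumes "b > 2"
  obtains t where "t > 0" "\<And>x y. \<gamma> b x + \<gamma> b y = 2 * \<gamma> b ((x + y) / 2) * cosh (t * (x - y) / 2)"
proof -
  obtain t where t: "t > 0" "\<And>x. \<gamma> b x = 2 * sinh (t * x)"
    using \<gamma>_eq_sinh[OF assms] by metis
  have "\<gamma> b x + \<gamma> b y = 2 * \<gamma> b ((x + y) / 2) * cosh (t * (x - y) / 2)" for x y
  proof -
    define p q where "p = t * (x + y) / 2" and "q = t * (x - y) / 2"
    have "t * x = p + q" "t * y = p - q" "t * ((x + y) / 2) = p"
      by (simp_all add: p_def q_def field_simps)
    then show ?thesis
      unfolding t q_def[symmetric] by (simp add: sinh_add sinh_diff)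
  qed
  with t that show thesis
    by blast
qed

lemma \<gamma>_midpoint_le:
  assumes "b > 2" "x + y \<ge> 0"
  shows "2 * \<gamma> b ((x + y) / 2) \<le> \<gamma> b x + \<gamma> b y"
proof (rule \<gamma>_add[OF assms(1)])
  fix t
  assume t: "\<And>x y. \<gamma> b x + \<gamma> b y = 2 * \<gamma> b ((x + y) / 2) * cosh (t * (x - y) / 2)"
  show ?thesis
    unfolding t using \<gamma>_nonneg[of b "(x + y) / 2"] assms
      mult_left_mono[OF cosh_real_ge_1, of "2 * \<gamma> b ((x + y) / 2)"] by simp
qed

text \<open>Since cosh increases with the absolute value of its argument, moving two arguments apart
  at a fixed nonnegative sum increases the sum of their \<open>\<gamma>\<close> values.\<close>

lemma \<gamma>_add_le:
  assumes "b > 2" "x + y \<ge> 0" "x + y = u + v" "\<bar>x - y\<bar> \<le> \<bar>u - v\<bar>"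
  shows "\<gamma> b x + \<gamma> b y \<le> \<gamma> b u + \<gamma> b v"
proof (rule \<gamma>_add[OF assms(1)])
  fix t :: real
  assume t: "\<And>x y. \<gamma> b x + \<gamma> b y = 2 * \<gamma> b ((x + y) / 2) * cosh (t * (x - y) / 2)" and "t > 0"
  have "cosh \<bar>t * (x - y) / 2\<bar> \<le> cosh \<bar>t * (u - v) / 2\<bar>"
    using assms(4) \<open>t > 0\<close> by (simp add: cosh_real_nonneg_le_iff abs_mult del: cosh_real_abs)
  then have "cosh (t * (x - y) / 2) \<le> cosh (t * (u - v) / 2)"
    by (simp only: cosh_real_abs)
  then show ?thesis
    unfolding t assms(3)[symmetric] using \<gamma>_nonneg[of b "(x + y) / 2"] assms
    by (simp add: mult_left_mono)
qed

text \<open>By the recurrence, \<open>(b - 2) * \<gamma> b x\<close> is the second difference of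
  \<open>\<gamma> b\<close> at \<open>x\<close>, so the sum telescopes.\<close>

lemma sum_\<gamma>:
  assumes "b > 2"
  shows "(b - 2) * (\<Sum>j<m. \<gamma> b (real j + 1)) = \<gamma> b (real m + 1) - \<gamma> b (real m) - \<gamma> b 1"
proof (induction m)
  case 0
  show ?case using assms by simp
next
  case (Suc m)
  then show ?case
    using \<gamma>_rec[OF assms, of "real m + 1"] by (simp add: algebra_simps)
qed

lemma sum_\<gamma>_rev:
  assumes "b > 2" "m \<le> n"
  shows "(b - 2) * (\<Sum>j=m..<n. \<gamma> b (real n - real j))
    = \<gamma> b (real n - real m + 1) - \<gamma> b (real n - real m) - \<gamma> b 1"
proof -
  have "(\<Sum>j=m..<n. \<gamma> b (real n - real j)) = (\<Sum>j<n - m. \<gamma> b (real j + 1))"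
    by (rule sum.reindex_bij_witness[where i = "\<lambda>j. n - Suc j" and j = "\<lambda>j. n - Suc j"])
      (auto simp: of_nat_diff algebra_simps)
  then show ?thesis
    using sum_\<gamma>[OF assms(1), of "n - m"] assms(2) by (simp add: of_nat_diff algebra_simps)
qed

section \<open>Action of the matrix on sampled functions, and the denominator of
  \<open>K\<close>\<close>

text \<open>Vectors are sampled at \<open>1, \<dots>, n\<close>; the values at \<open>0\<close> and \<open>n + 1\<close> are arbitrary, since the
  boundary terms remove them again.\<close>

lemma T_tilde_mult:
  fixes F :: "real \<Rightarrow> real"
  assumes "n \<ge> 2" "i < n"
  shows "(\<Sum>k<n. T_tilde n b bt $$ (i, k) * F (real k + 1))
    = b * F (real i + 1) - F (real i) - F (real i + 2)
      + (if i = 0 then F 0 + (bt - b) * F 1 else 0)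
      + (if i = n - 1 then F (real n + 1) + (bt - b) * F (real n) else 0)"
proof -
  define d where "d = (if i = 0 \<or> i = n - 1 then bt else b)"
  have "(\<Sum>k<n. T_tilde n b bt $$ (i, k) * F (real k + 1))
      = (\<Sum>k<n. (if k = i then d * F (real k + 1) else 0) - (if k = Suc i then F (real k + 1) else 0)
          - (if Suc k = i then F (real k + 1) else 0))"
    using assms by (intro sum.cong) (auto simp: T_tilde_def d_def)
  also have "\<dots> = d * F (real i + 1) - (if Suc i < n then F (real i + 2) else 0)
      - (if i = 0 then 0 else F (real i))"
    using assms by (cases i) (auto simp: sum_subtractf add.commute)
  also have "\<dots> = b * F (real i + 1) - F (real i) - F (real i + 2)
      + (if i = 0 then F 0 + (bt - b) * F 1 else 0)
      + (if i = n - 1 then F (real n + 1) + (bt - b) * F (real n) else 0)"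
  proof (cases "i = n - 1")
    case True
    \<comment> \<open>Because \<open>n \<ge> 2\<close>, the last row is not also the first, so only
      one of the two boundary terms is present.\<close>
    then have "real n = real i + 1" "\<not> Suc i < n" "i \<noteq> 0"
      using assms by auto
    then show ?thesis
      using True by (simp add: d_def algebra_simps)
  next
    case False
    then show ?thesis
      using assms by (auto simp: d_def algebra_simps)
  qed
  finally show ?thesis .
qed

text \<open>A zero of the denominator of \<open>K\<close> makes one of the vectors \<open>\<gamma>(n + 1 - x) \<plusminus> \<gamma>(x)\<close>
  a kernel vector.\<close>

lemma T_tilde_denominator_nonzero:
  fixes b bt :: real
  assumes n: "n \<ge> 2" and b: "b > 2" and inv: "invertible_mat (T_tilde n b bt)"
  shows "(\<gamma> b (real n + 1) + (bt - b) * \<gamma> b (real n))\<^sup>2 - ((bt - b) * \<gamma> b 1)\<^sup>2 \<noteq> 0"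
proof
  define \<beta> where "\<beta> = bt - b"
  define A where "A = T_tilde n b bt"
  assume "(\<gamma> b (real n + 1) + (bt - b) * \<gamma> b (real n))\<^sup>2 - ((bt - b) * \<gamma> b 1)\<^sup>2 = 0"
  then have "(\<gamma> b (real n + 1) + \<beta> * \<gamma> b (real n) + \<beta> * \<gamma> b 1) *
      (\<gamma> b (real n + 1) + \<beta> * \<gamma> b (real n) - \<beta> * \<gamma> b 1) = 0"
    by (simp add: \<beta>_def power2_eq_square algebra_simps)
  then obtain \<sigma> :: real where \<sigma>: "\<sigma> = 1 \<or> \<sigma> = - 1"
    and zero: "\<gamma> b (real n + 1) + \<beta> * \<gamma> b (real n) + \<sigma> * \<beta> * \<gamma> b 1 = 0"
    by (metis diff_conv_add_uminus minus_mult_left mult_1 mult_eq_0_iff)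
  define w where "w = (\<lambda>x. \<gamma> b (real n + 1 - x) + \<sigma> * \<gamma> b x)"
  have A: "A \<in> carrier_mat n n"
    by (simp add: A_def T_tilde_def)
  define v where "v = vec n (\<lambda>k. w (real k + 1))"
  have v: "v \<in> carrier_vec n"
    by (simp add: v_def)
  have w_rec: "b * w (x + 1) - w x - w (x + 2) = 0" for x
    using \<gamma>_rec[OF b, of "x + 1"] \<gamma>_rec[OF b, of "real n - x"]
    by (simp add: w_def algebra_simps)
  have w_0: "w 0 + \<beta> * w 1 = 0"
    using zero b by (simp add: w_def algebra_simps)
  \<comment> \<open>Since \<open>\<sigma> * \<sigma> = 1\<close>, the left side is
    \<open>\<sigma>\<close> times the expression that vanishes by \<open>zero\<close>.\<close>
  have w_n: "w (real n + 1) + \<beta> * w (real n) = 0"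
    using \<sigma> zero b by (auto simp: w_def algebra_simps)
  have "A *\<^sub>v v = 0\<^sub>v n"
  proof (intro eq_vecI)
    fix i assume "i < dim_vec (0\<^sub>v n :: real vec)"
    then have i: "i < n" by simp
    have "(A *\<^sub>v v) $ i = (\<Sum>k<n. A $$ (i, k) * w (real k + 1))"
      using A i by (simp add: v_def scalar_prod_def lessThan_atLeast0)
    also have "\<dots> = 0"
      unfolding A_def T_tilde_mult[OF n i] using w_rec w_0 w_n by (simp add: \<beta>_def)
    finally show "(A *\<^sub>v v) $ i = 0\<^sub>v n $ i"
      using i by simp
  qed (use A in simp)
  moreover obtain B where B: "B * A = 1\<^sub>m (dim_row B)" "A * B = 1\<^sub>m n"
    using inv A unfolding A_def[symmetric] invertible_mat_def inverts_mat_def by auto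
  have "dim_col B = n" 
    using B(2) by (metis index_mult_mat(3) index_one_mat(3))
  moreover have "dim_row B = n"
    using B(1) A by (metis carrier_matD(2) index_mult_mat(3) index_one_mat(3))
  ultimately have "B \<in> carrier_mat n n" and "B *\<^sub>v (A *\<^sub>v v) = B *\<^sub>v 0\<^sub>v n"
    by auto
  moreover from this have "B *\<^sub>v 0\<^sub>v n = 0\<^sub>v n"
    by auto
  ultimately have "v = 0\<^sub>v n"
    using B A v \<open>dim_row B = n\<close> by (metis assoc_mult_mat_vec one_mult_mat_vec)
  then have "w 1 = 0"
    using n by (auto simp: v_def vec_eq_iff dest: spec[of _ 0])
  \<comment> \<open>\<open>w 1\<close> is
    \<open>\<gamma> b (real n) + \<sigma> * \<gamma> b 1\<close>. The strict inequality makes it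
    positive even for \<open>\<sigma> = - 1\<close>.\<close>
  moreover have "\<gamma> b 1 < \<gamma> b (real n)"
    using n b by (intro \<gamma>_strict_mono) auto
  moreover have "\<gamma> b 1 > 0"
    using b by (rule \<gamma>_pos) simp
  ultimately show False
    using \<sigma> by (auto simp: w_def)
qed

section \<open>Green function, corner correction and the explicit inverse\<close>

text \<open>The factors solve the recurrence and vanish at 0 and at \<open>n + 1\<close>
  respectively; the divisor is their discrete Wronskian. Real arguments allow evaluation at both
  boundary points and reflection without truncated subtraction.\<close>

definition green :: "real \<Rightarrow> real \<Rightarrow> real \<Rightarrow> real \<Rightarrow> real" where
  "green b n x y = \<gamma> b (min x y) * \<gamma> b (n + 1 - max x y) / (\<gamma> b 1 * \<gamma> b (n + 1))"

text \<open>A rank-two kernel. The shifted factors \<open>\<gamma> b (n - x)\<close> and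
  \<open>\<gamma> b (x - 1)\<close> keep every product nonnegative at the grid points and make
  \<open>\<beta>\<close> enter linearly, which yields the two \<open>K\<close> terms of the bound
  separately.\<close>

definition corner :: "real \<Rightarrow> real \<Rightarrow> real \<Rightarrow> real \<Rightarrow> real \<Rightarrow> real" where
  "corner b n \<beta> x y = \<gamma> b (n + 1 - x) * \<gamma> b (n + 1 - y) + \<gamma> b x * \<gamma> b y
     + \<beta> * (\<gamma> b (n - x) * \<gamma> b (n + 1 - y) + \<gamma> b (x - 1) * \<gamma> b y)"

text \<open>Off the diagonal one factor is constant in \<open>i\<close> and the other solves the
  recurrence. On the diagonal the change of branch leaves exactly the discrete Wronskian
  \<open>W\<close>.\<close>

lemma green_rec:
  fixes i j n :: nat
  assumes b: "b > 2" and "j < n"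
  shows "b * green b n (real i + 1) (real j + 1) - green b n (real i) (real j + 1)
    - green b n (real i + 2) (real j + 1) = (if i = j then 1 else 0)"
proof -
  define W where "W = \<gamma> b 1 * \<gamma> b (real n + 1)"
  have W: "W \<noteq> 0"
    using \<gamma>_pos[OF b, of 1] \<gamma>_pos[OF b, of "real n + 1"] by (simp add: W_def)
  have rec1: "b * \<gamma> b (real i + 1) = \<gamma> b (real i) + \<gamma> b (real i + 2)"
    using \<gamma>_rec[OF b, of "real i + 1"] by (simp add: add.commute)
  have rec2: "b * \<gamma> b (real n - real i) = \<gamma> b (real n - real i - 1) + \<gamma> b (real n - real i + 1)"
    using \<gamma>_rec[OF b, of "real n - real i"] by simp
  consider "i = j" | "i < j" | "i > j"
    by linarith
  then show ?thesis
  proof cases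
    case 1
    have "\<gamma> b (real i + 2) * \<gamma> b (real n - real i) - \<gamma> b (real i + 1) * \<gamma> b (real n - real i - 1) = W"
      using \<gamma>_mult_diff[OF b, of "real i + 1" 1 "real n - real i - 1"] by (simp add: W_def add.commute)
    then have "b * (\<gamma> b (real i + 1) * \<gamma> b (real n - real i)) - \<gamma> b (real i) * \<gamma> b (real n - real i)
      - \<gamma> b (real i + 1) * \<gamma> b (real n - real i - 1) = W"
      using arg_cong[OF rec1, of "\<lambda>z. z * \<gamma> b (real n - real i)"] by (simp add: algebra_simps)
    moreover have "green b n (real i + 1) (real j + 1) = \<gamma> b (real i + 1) * \<gamma> b (real n - real i) / W"
      "green b n (real i) (real j + 1) = \<gamma> b (real i) * \<gamma> b (real n - real i) / W"
      "green b n (real i + 2) (real j + 1) = \<gamma> b (real i + 1) * \<gamma> b (real n - real i - 1) / W"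
      using 1 by (simp_all add: green_def W_def algebra_simps)
    ultimately show ?thesis
      using 1 W by (simp add: diff_divide_distrib[symmetric])
  next
    case 2
    have "b * (\<gamma> b (real i + 1) * c) - \<gamma> b (real i) * c - \<gamma> b (real i + 2) * c = 0" for c
      using rec1 by Groebner_Basis.algebra
    then show ?thesis
      using 2 by (simp add: green_def min_def max_def diff_divide_distrib[symmetric] flip: W_def)
  next
    case 3
    \<comment> \<open>For \<open>i = j + 1\<close> the left neighbour lies on the diagonal, where
      both branches of \<open>green\<close> agree.\<close>
    then have "min (real i) (real j + 1) = real j + 1" "max (real i) (real j + 1) = real i"
      by simp_all
    then have "green b n (real i) (real j + 1) = \<gamma> b (real j + 1) * \<gamma> b (real n - real i + 1) / W"
      "green b n (real i + 1) (real j + 1) = \<gamma> b (real j + 1) * \<gamma> b (real n - real i) / W"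
      "green b n (real i + 2) (real j + 1) = \<gamma> b (real j + 1) * \<gamma> b (real n - real i - 1) / W"
      using 3 by (simp_all add: green_def W_def algebra_simps)
    moreover have "b * (c * \<gamma> b (real n - real i)) - c * \<gamma> b (real n - real i + 1)
      - c * \<gamma> b (real n - real i - 1) = 0" for c
      using rec2 by Groebner_Basis.algebra
    ultimately show ?thesis
      using 3 by (simp add: diff_divide_distrib[symmetric])
  qed
qed

text \<open>Each factor depending on \<open>x\<close> is a shift or reflection of
  \<open>\<gamma>\<close>, hence solves the homogeneous recurrence.\<close>

lemma corner_rec:
  assumes "b > 2"
  shows "b * corner b n \<beta> (x + 1) y - corner b n \<beta> x y - corner b n \<beta> (x + 2) y = 0"
proof -
  have rec: "b * \<gamma> b (x + 1) = \<gamma> b x + \<gamma> b (x + 2)"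
    "b * \<gamma> b (n - x) = \<gamma> b (n - x - 1) + \<gamma> b (n - x + 1)"
    "b * \<gamma> b (n - x - 1) = \<gamma> b (n - x - 2) + \<gamma> b (n - x)"
    "b * \<gamma> b x = \<gamma> b (x - 1) + \<gamma> b (x + 1)"
    using \<gamma>_rec[OF assms, of "x + 1"] \<gamma>_rec[OF assms, of "n - x"] \<gamma>_rec[OF assms, of "n - x - 1"]
      \<gamma>_rec[OF assms, of x]
    by (simp_all add: algebra_simps)
  have arg: "n + 1 - x = n - x + 1" "n + 1 - (x + 1) = n - x" "n + 1 - (x + 2) = n - x - 1"
    "n - (x + 1) = n - x - 1" "n - (x + 2) = n - x - 2" "x + 1 - 1 = x" "x + 2 - 1 = x + 1"
    by simp_all
  show ?thesis
    unfolding corner_def arg using rec by Groebner_Basis.algebra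
qed

text \<open>Reversal symmetry of the matrix. With \<open>corner_reflect\<close> it reduces the right
  boundary condition to the left one.\<close>

lemma green_reflect: "green b n (n + 1 - x) (n + 1 - y) = green b n x y"
  by (simp add: green_def min_def max_def mult.commute)

lemma corner_reflect: "corner b n \<beta> (n + 1 - x) (n + 1 - y) = corner b n \<beta> x y"
  by (simp add: corner_def algebra_simps)

text \<open>In \<open>corner b n \<beta> 0 y + \<beta> * corner b n \<beta> 1 y\<close> the terms
  with \<open>\<gamma> b y\<close> cancel, as \<open>\<gamma>\<close> is odd. What remains is a
  multiple of \<open>\<gamma> b (n + 1 - y)\<close> whose factor, times
  \<open>\<gamma> b (n + 1)\<close>, is the denominator of \<open>K\<close>. The hypothesis on
  \<open>K\<close> is multiplied out to avoid division.\<close>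

lemma boundary_left:
  assumes b: "b > 2" and n: "n > 0" and y: "1 \<le> y" "y \<le> n"
    and K: "K * ((\<gamma> b (n + 1) + \<beta> * \<gamma> b n)\<^sup>2 - (\<beta> * \<gamma> b 1)\<^sup>2) = \<beta>"
  shows "green b n 0 y - K * corner b n \<beta> 0 y + \<beta> * (green b n 1 y - K * corner b n \<beta> 1 y) = 0"
proof -
  define g where "g = \<gamma> b (n + 1)"
  have g: "g > 0" "\<gamma> b 1 > 0"
    using \<gamma>_pos[OF b] n by (auto simp: g_def)
  have "(\<gamma> b n)\<^sup>2 - (\<gamma> b 1)\<^sup>2 = g * \<gamma> b (n - 1)"
    using \<gamma>_mult_diff[OF b, of 1 "n - 1" 1] by (simp add: g_def power2_eq_square mult.commute add.commute)
  then have K': "K * g * (g + 2 * \<beta> * \<gamma> b n + \<beta>\<^sup>2 * \<gamma> b (n - 1)) = \<beta>"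
    using K unfolding g_def[symmetric] by Groebner_Basis.algebra
  have "corner b n \<beta> 0 y + \<beta> * corner b n \<beta> 1 y
      = \<gamma> b (n + 1 - y) * (g + 2 * \<beta> * \<gamma> b n + \<beta>\<^sup>2 * \<gamma> b (n - 1))"
    using b by (simp add: corner_def g_def \<gamma>_uminus power2_eq_square algebra_simps)
  then have "g * K * (corner b n \<beta> 0 y + \<beta> * corner b n \<beta> 1 y) = \<beta> * \<gamma> b (n + 1 - y)"
    using K' by Groebner_Basis.algebra
  moreover have "green b n 0 y = 0" "g * green b n 1 y = \<gamma> b (n + 1 - y)"
    using y b g by (simp_all add: green_def flip: g_def)
  ultimately have "g * (green b n 0 y - K * corner b n \<beta> 0 y
      + \<beta> * (green b n 1 y - K * corner b n \<beta> 1 y)) = 0"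
    by Groebner_Basis.algebra
  with g show ?thesis
    by simp
qed

lemma boundary_right:
  assumes "b > 2" "n > 0" "1 \<le> y" "y \<le> n"
    and "K * ((\<gamma> b (n + 1) + \<beta> * \<gamma> b n)\<^sup>2 - (\<beta> * \<gamma> b 1)\<^sup>2) = \<beta>"
  shows "green b n (n + 1) y - K * corner b n \<beta> (n + 1) y
    + \<beta> * (green b n n y - K * corner b n \<beta> n y) = 0"
  using boundary_left[of b n "n + 1 - y" K \<beta>] assms
    green_reflect[of b n 0 "n + 1 - y"] green_reflect[of b n 1 "n + 1 - y"]
    corner_reflect[of b n \<beta> 0 "n + 1 - y"] corner_reflect[of b n \<beta> 1 "n + 1 - y"]
  by simp

lemma T_tilde_inverse_eq:
  fixes b bt K :: real
  assumes n: "n \<ge> 2" and b: "b > 2"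
    and K: "K * ((\<gamma> b (real n + 1) + (bt - b) * \<gamma> b (real n))\<^sup>2 - ((bt - b) * \<gamma> b 1)\<^sup>2) = bt - b"
    and inv: "invertible_mat (T_tilde n b bt)"
  shows "the (mat_inverse (T_tilde n b bt)) = mat n n (\<lambda>(i, j).
    green b n (real i + 1) (real j + 1) - K * corner b n (bt - b) (real i + 1) (real j + 1))"
    (is "_ = mat n n (\<lambda>(i, j). ?F j (real i + 1))")
proof -
  define A where "A = T_tilde n b bt"
  define X where "X = mat n n (\<lambda>(i, j). ?F j (real i + 1))"
  have A: "A \<in> carrier_mat n n" and X: "X \<in> carrier_mat n n"
    by (simp_all add: A_def T_tilde_def X_def)
  have AX: "A * X = 1\<^sub>m n"
  proof (intro eq_matI)
    fix i j assume "i < dim_row (1\<^sub>m n :: real mat)" "j < dim_col (1\<^sub>m n :: real mat)"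
    then have i: "i < n" and j: "j < n" by auto
    have "(A * X) $$ (i, j) = (\<Sum>k<n. A $$ (i, k) * ?F j (real k + 1))"
      using A i j by (simp add: X_def scalar_prod_def lessThan_atLeast0)
    \<comment> \<open>The two boundary conditions remove the corner terms, so only the recurrence is
      left.\<close>
    also have "\<dots> = b * ?F j (real i + 1) - ?F j (real i) - ?F j (real i + 2)"
      unfolding A_def T_tilde_mult[OF n i, of b bt "?F j"]
      using boundary_left[OF b _ _ _ K, of "real j + 1"] boundary_right[OF b _ _ _ K, of "real j + 1"] j
      by simp
    also have "\<dots> = b * green b n (real i + 1) (real j + 1) - green b n (real i) (real j + 1)
        - green b n (real i + 2) (real j + 1)
        - K * (b * corner b n (bt - b) (real i + 1) (real j + 1)
          - corner b n (bt - b) (real i) (real j + 1) - corner b n (bt - b) (real i + 2) (real j + 1))"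
      by (simp only: algebra_simps)
    also have "\<dots> = (if i = j then 1 else 0)"
      by (simp only: green_rec[OF b j] corner_rec[OF b] mult_zero_right diff_zero)
    finally show "(A * X) $$ (i, j) = 1\<^sub>m n $$ (i, j)"
      using i j by simp
  qed (use A X in auto)
  \<comment> \<open>\<open>the\<close> gives the inverse only for a \<open>Some\<close> value. The
    two-sided inverse \<open>X\<close> makes \<open>A\<close> a unit, and uniqueness of inverses
    then identifies the result with \<open>X\<close>.\<close>
  have "mat_inverse A \<noteq> None"
  proof
    assume "mat_inverse A = None"
    then have "A \<notin> Units (ring_mat TYPE(real) n ())"
      by (rule mat_inverse(1)[OF A])
    moreover have "X * A = 1\<^sub>m n"
      using mat_mult_left_right_inverse[OF A X AX] .
    ultimately show False
      using A X AX by (auto simp: Units_def ring_mat_def)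
  qed
  then obtain B where B: "mat_inverse A = Some B"
    by blast
  then have "B * A = 1\<^sub>m n" "B \<in> carrier_mat n n"
    using mat_inverse(2)[OF A B] by auto
  then have "B = X"
    by (metis A X AX assoc_mult_mat left_mult_one_mat right_mult_one_mat)
  then show ?thesis
    using B by (simp add: A_def X_def)
qed

section \<open>Row sums and the norm bound\<close>

text \<open>The result is the constant solution \<open>1 / (b - 2)\<close> of the recurrence with
  right side 1, minus the homogeneous solution with the same values at 0 and \<open>n + 1\<close>.
  The proof splits the row at the diagonal and telescopes both parts.\<close>

lemma sum_green:
  fixes i n :: nat
  assumes b: "b > 2" and i: "i < n"
  shows "(\<Sum>j<n. green b n (real i + 1) (real j + 1))
    = (\<gamma> b (real n + 1) - (\<gamma> b (real i + 1) + \<gamma> b (real n - real i))) / ((b - 2) * \<gamma> b (real n + 1))"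
proof -
  define W where "W = \<gamma> b 1 * \<gamma> b (real n + 1)"
  have pos: "\<gamma> b 1 > 0" "\<gamma> b (real n + 1) > 0"
    using \<gamma>_pos[OF b] by auto
  have "(\<Sum>j<n. green b n (real i + 1) (real j + 1))
      = (\<Sum>j<Suc i. green b n (real i + 1) (real j + 1)) + (\<Sum>j=Suc i..<n. green b n (real i + 1) (real j + 1))"
    using i by (simp only: lessThan_atLeast0) (rule sum.atLeastLessThan_concat[symmetric], auto)
  also have "(\<Sum>j<Suc i. green b n (real i + 1) (real j + 1))
      = (\<Sum>j<Suc i. \<gamma> b (real j + 1)) * \<gamma> b (real n - real i) / W"
    unfolding sum_distrib_right sum_divide_distrib
    by (intro sum.cong) (auto simp: green_def W_def)
  also have "(\<Sum>j=Suc i..<n. green b n (real i + 1) (real j + 1))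
      = (\<Sum>j=Suc i..<n. \<gamma> b (real n - real j)) * \<gamma> b (real i + 1) / W"
    unfolding sum_distrib_right sum_divide_distrib
    by (intro sum.cong) (auto simp: green_def W_def)
  finally have "W * (\<Sum>j<n. green b n (real i + 1) (real j + 1))
      = (\<Sum>j<Suc i. \<gamma> b (real j + 1)) * \<gamma> b (real n - real i)
        + (\<Sum>j=Suc i..<n. \<gamma> b (real n - real j)) * \<gamma> b (real i + 1)"
    using pos by (simp add: W_def field_simps)
  then have "(b - 2) * (W * (\<Sum>j<n. green b n (real i + 1) (real j + 1)))
      = ((b - 2) * (\<Sum>j<Suc i. \<gamma> b (real j + 1))) * \<gamma> b (real n - real i)
        + ((b - 2) * (\<Sum>j=Suc i..<n. \<gamma> b (real n - real j))) * \<gamma> b (real i + 1)"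
    by Groebner_Basis.algebra
  also have "\<dots> = (\<gamma> b (real i + 2) - \<gamma> b (real i + 1) - \<gamma> b 1) * \<gamma> b (real n - real i)
        + (\<gamma> b (real n - real i) - \<gamma> b (real n - real i - 1) - \<gamma> b 1) * \<gamma> b (real i + 1)"
  proof -
    have "real (Suc i) = real i + 1" "real (Suc i) + 1 = real i + 2"
      "real n - real (Suc i) + 1 = real n - real i" "real n - real (Suc i) = real n - real i - 1"
      by simp_all
    then show ?thesis
      using sum_\<gamma>[OF b, of "Suc i"] sum_\<gamma>_rev[OF b, of "Suc i" n] i by (simp only:)
  qed
  \<comment> \<open>The products
    \<open>\<gamma> b (real i + 1) * \<gamma> b (real n - real i)\<close> cancel, and the remaining
    difference of products is \<open>W\<close>.\<close>
  also have "\<dots> = W - \<gamma> b 1 * (\<gamma> b (real i + 1) + \<gamma> b (real n - real i))"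
    using \<gamma>_mult_diff[OF b, of "real i + 1" 1 "real n - real i - 1"]
    by (simp add: W_def algebra_simps)
  finally have "\<gamma> b 1 * ((b - 2) * \<gamma> b (real n + 1) * (\<Sum>j<n. green b n (real i + 1) (real j + 1)))
      = \<gamma> b 1 * (\<gamma> b (real n + 1) - (\<gamma> b (real i + 1) + \<gamma> b (real n - real i)))"
    by (simp add: W_def algebra_simps)
  then have "(b - 2) * \<gamma> b (real n + 1) * (\<Sum>j<n. green b n (real i + 1) (real j + 1))
      = \<gamma> b (real n + 1) - (\<gamma> b (real i + 1) + \<gamma> b (real n - real i))"
    using pos by simp
  then show ?thesis
    using pos b by (simp add: eq_divide_eq mult.commute)
qed

text \<open>After the triangle inequality both sums over \<open>j\<close> equal \<open>S\<close>,
  leaving the row factors \<open>p\<close> and \<open>q\<close>, which are bounded by their values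
  at the end rows.\<close>

lemma sum_abs_corner_le:
  fixes i n :: nat
  assumes b: "b > 2" and i: "i < n"
  shows "(\<Sum>j<n. \<bar>corner b n \<beta> (real i + 1) (real j + 1)\<bar>)
    \<le> (\<gamma> b (real n) + \<gamma> b 1) * (\<gamma> b (real n + 1) - \<gamma> b (real n) - \<gamma> b 1) / (b - 2)
      + \<bar>\<beta>\<bar> * \<gamma> b (real n - 1) * \<gamma> b (real n + 1) / (b - 2)"
proof -
  define S where "S = (\<Sum>j<n. \<gamma> b (real j + 1))"
  define p q where "p = \<gamma> b (real n - real i) + \<gamma> b (real i + 1)"
    and "q = \<gamma> b (real n - real i - 1) + \<gamma> b (real i)"
  have S: "S = (\<gamma> b (real n + 1) - \<gamma> b (real n) - \<gamma> b 1) / (b - 2)"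
    using sum_\<gamma>[OF b, of n] b by (simp add: S_def field_simps)
  have S': "(\<Sum>j<n. \<gamma> b (real n - real j)) = S"
    using sum_\<gamma>_rev[OF b, of 0 n] b by (simp add: S lessThan_atLeast0 field_simps)
  have S0: "0 \<le> S"
    unfolding S_def using b by (intro sum_nonneg \<gamma>_nonneg) auto
  \<comment> \<open>This coarser bound is applied only to the \<open>\<beta>\<close> part, where it
    produces the factor \<open>\<gamma> b (real n + 1)\<close> of the last term.\<close>
  have S_le: "S \<le> \<gamma> b (real n + 1) / (b - 2)"
    unfolding S using b \<gamma>_nonneg[OF b, of "real n"] \<gamma>_nonneg[OF b, of 1]
    by (intro divide_right_mono) auto
  \<comment> \<open>The arguments in \<open>p\<close> sum to \<open>n + 1\<close> and those in
    \<open>q\<close> to \<open>n - 1\<close>, whatever \<open>i\<close> is. They are farthest apart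
    in the first and last rows.\<close>
  have p: "p \<le> \<gamma> b (real n) + \<gamma> b 1"
    unfolding p_def using i b by (intro \<gamma>_add_le) auto
  have q0: "0 \<le> q"
    unfolding q_def using i b by (intro add_nonneg_nonneg \<gamma>_nonneg) auto
  have "q \<le> \<gamma> b (real n - 1) + \<gamma> b 0"
    unfolding q_def using i b by (intro \<gamma>_add_le) auto
  then have q: "q \<le> \<gamma> b (real n - 1)"
    using b by simp
  have "(\<Sum>j<n. \<bar>corner b n \<beta> (real i + 1) (real j + 1)\<bar>) \<le>
     (\<Sum>j<n. \<gamma> b (real n - real i) * \<gamma> b (real n - real j) + \<gamma> b (real i + 1) * \<gamma> b (real j + 1)
     + \<bar>\<beta>\<bar> * (\<gamma> b (real n - real i - 1) * \<gamma> b (real n - real j) + \<gamma> b (real i) * \<gamma> b (real j + 1)))"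
  proof (intro sum_mono)
    fix j assume "j \<in> {..<n}"
    then have nonneg: "\<gamma> b (real n - real i) \<ge> 0" "\<gamma> b (real n - real j) \<ge> 0" "\<gamma> b (real i + 1) \<ge> 0"
      "\<gamma> b (real j + 1) \<ge> 0" "\<gamma> b (real n - real i - 1) \<ge> 0" "\<gamma> b (real i) \<ge> 0"
      using i b by (auto intro!: \<gamma>_nonneg)
    have arg: "real n - (real i + 1) = real n - real i - 1"
      by simp
    show "\<bar>corner b n \<beta> (real i + 1) (real j + 1)\<bar>
      \<le> \<gamma> b (real n - real i) * \<gamma> b (real n - real j) + \<gamma> b (real i + 1) * \<gamma> b (real j + 1)
     + \<bar>\<beta>\<bar> * (\<gamma> b (real n - real i - 1) * \<gamma> b (real n - real j) + \<gamma> b (real i) * \<gamma> b (real j + 1))"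
      unfolding corner_def arg using nonneg
      by (intro order.trans[OF abs_triangle_ineq] add_mono) (simp_all add: abs_mult)
  qed
  also have "\<dots> = p * S + \<bar>\<beta>\<bar> * (q * S)"
    unfolding sum.distrib sum_distrib_left[symmetric] S' S_def[symmetric]
    by (simp add: p_def q_def algebra_simps)
  also have "\<dots> \<le> (\<gamma> b (real n) + \<gamma> b 1) * S + \<bar>\<beta>\<bar> * (\<gamma> b (real n - 1) * (\<gamma> b (real n + 1) / (b - 2)))"
    using p q q0 S0 S_le by (intro add_mono mult_right_mono mult_left_mono mult_mono) auto
  finally show ?thesis
    by (simp add: S mult.assoc)
qed

theorem theorem3p10:
  fixes n :: nat and b bt \<beta> K :: real
  assumes "n \<ge> 3"
    and "b > 2"
    and "bt < 1"
    and "invertible_mat (T_tilde n b bt)"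
    and "\<beta> = bt - b"
    and "K = \<beta> / ((\<gamma> b (real n + 1) + \<beta> * \<gamma> b (real n))\<^sup>2 - (\<beta> * \<gamma> b 1)\<^sup>2)"
  shows "mat_norm_inf (the (mat_inverse (T_tilde n b bt)))
    \<le> (\<gamma> b (real n + 1) - 2 * \<gamma> b ((real n + 1) / 2)) / ((b - 2) * \<gamma> b (real n + 1))
      + \<bar>K\<bar> / (b - 2) * (\<gamma> b (real n) + \<gamma> b 1)
          * (\<gamma> b (real n + 1) - \<gamma> b (real n) - \<gamma> b 1)
      + \<bar>K * \<beta>\<bar> / (b - 2) * \<gamma> b (real n - 1) * \<gamma> b (real n + 1)"
    (is "_ \<le> ?bound")
proof -
  note b = \<open>b > 2\<close>
  have n: "n \<ge> 2"
    using assms(1) by simp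
  \<comment> \<open>Invertibility rules out a zero denominator, for which the division in
    \<open>K\<close> would return 0.\<close>
  have K: "K * ((\<gamma> b (real n + 1) + \<beta> * \<gamma> b (real n))\<^sup>2 - (\<beta> * \<gamma> b 1)\<^sup>2) = \<beta>"
    using T_tilde_denominator_nonzero[OF n b assms(4)] by (simp add: assms(5,6))
  have row: "(\<Sum>j<n. \<bar>green b n (real i + 1) (real j + 1) - K * corner b n \<beta> (real i + 1) (real j + 1)\<bar>)
      \<le> ?bound" if i: "i < n" for i
  proof -
    have green_nonneg: "green b n (real i + 1) (real j + 1) \<ge> 0" if "j < n" for j
      unfolding green_def using i that b
      by (intro divide_nonneg_nonneg mult_nonneg_nonneg \<gamma>_nonneg) auto
    have "(\<Sum>j<n. \<bar>green b n (real i + 1) (real j + 1) - K * corner b n \<beta> (real i + 1) (real j + 1)\<bar>)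
      \<le> (\<Sum>j<n. green b n (real i + 1) (real j + 1) + \<bar>K\<bar> * \<bar>corner b n \<beta> (real i + 1) (real j + 1)\<bar>)"
      by (intro sum_mono order.trans[OF abs_triangle_ineq4] add_mono)
        (auto simp: abs_mult green_nonneg)
    also have "\<dots> = (\<Sum>j<n. green b n (real i + 1) (real j + 1))
        + \<bar>K\<bar> * (\<Sum>j<n. \<bar>corner b n \<beta> (real i + 1) (real j + 1)\<bar>)"
      by (simp add: sum.distrib sum_distrib_left)
    also have "\<dots> \<le> (\<gamma> b (real n + 1) - 2 * \<gamma> b ((real n + 1) / 2)) / ((b - 2) * \<gamma> b (real n + 1))
      + \<bar>K\<bar> * ((\<gamma> b (real n) + \<gamma> b 1) * (\<gamma> b (real n + 1) - \<gamma> b (real n) - \<gamma> b 1) / (b - 2)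
      + \<bar>\<beta>\<bar> * \<gamma> b (real n - 1) * \<gamma> b (real n + 1) / (b - 2))"
    proof (intro add_mono mult_left_mono sum_abs_corner_le[OF b i])
      \<comment> \<open>The arguments \<open>real i + 1\<close> and \<open>real n - real i\<close>
        have the fixed midpoint \<open>(real n + 1) / 2\<close>, so this bound is uniform in the
        row.\<close>
      show "(\<Sum>j<n. green b n (real i + 1) (real j + 1))
        \<le> (\<gamma> b (real n + 1) - 2 * \<gamma> b ((real n + 1) / 2)) / ((b - 2) * \<gamma> b (real n + 1))"
        unfolding sum_green[OF b i]
        using b \<gamma>_midpoint_le[OF b, of "real i + 1" "real n - real i"] \<gamma>_nonneg[OF b, of "real n + 1"]
        by (intro divide_right_mono) (auto simp: add.commute)
    qed auto
    also have "\<dots> = ?bound"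
      by (simp add: abs_mult algebra_simps)
    finally show ?thesis .
  qed
  have inverse_eq: "the (mat_inverse (T_tilde n b bt)) = mat n n (\<lambda>(i, j).
    green b n (real i + 1) (real j + 1) - K * corner b n \<beta> (real i + 1) (real j + 1))"
    using T_tilde_inverse_eq[OF n b K[unfolded assms(5)] assms(4)] assms(5) by simp
  show ?thesis
    unfolding inverse_eq mat_norm_inf_def using n row by (subst Max_le_iff) (auto simp: lessThan_empty_iff)
qed

end
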